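(* (a) A function $\Psi:(0,\infty)\to[0,\infty)$ belongs to $\mathcal{CM}(0,\infty)$ if and only if for some (and hence for all) $c>0$ the function $-\Delta_c\Psi$ belongs to $\mathcal{CM}(0,\infty)$ and the Laplace representative measure of $-\Delta_c\Psi$ gives no mass to zero. (b) In this case, the sequence of functions $(-\Delta_{nc})\Psi$, $n\ge 1$, converges pointwise, locally uniformly, to a function in $\mathcal{CM}(0,\infty)$ that does not depend on $c$; more precisely $$\Psi(\lambda)=\lim_{x\to\infty}\Psi(x)+\lim_{n\to\infty}(-\Delta_{nc})\Psi(\lambda),\quad\lambda>0.$$ The same holds for the successive derivatives: the derivatives of each order of $(-\Delta_{nc})\Psi$ converge pointwise, locally uniformly, to the corresponding derivatives of the limit.
   Context: All functions are measurable. For $c>0$, $\Delta_c f(x)=f(x+c)-f(x)$. $\mathcal{CM}(0,\infty)$ is the class of completely monotone functions $f:(0,\infty)\to[0,\infty)$, i.e. infinitely differentiable functions with $(-1)^nf^{(n)}\ge 0$ for every integer $n\ge0$. Every $f\in\mathcal{CM}(0,\infty)$ is the Laplace transform $f(\lambda)=\int_{[0,\infty)}e^{-\lambda x}\,\nu(dx)$, $\lambda>0$, of a unique positive Radon measure $\nu$ on $[0,\infty)$, called the (Laplace) representative measure of $f$.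
   Formalization: In (a), "for some c" is false as stated (Ψ(x)=1+sin(2πx), c=1, is a counterexample); the formal version adds there that lim Ψ(x) as x→∞ exists, and proves the equivalence with "for all c>0" without that extra condition. *)

theory Defs
  imports "HOL-Analysis.Analysis"
begin

text \<open>
  Functions on \<open>(0,\<infinity>)\<close> are total functions on the reals of which only the values on
  \<open>{0<..}\<close> matter. As this set is open, iterating \<^const>\<open>deriv\<close> there is insensitive
  to the values elsewhere.
\<close>

definition completely_monotone :: "(real \<Rightarrow> real) \<Rightarrow> bool" where
  "completely_monotone f \<longleftrightarrow>
     (\<forall>n. \<forall>x>0. (deriv ^^ n) f differentiable (at x)) \<and>
     (\<forall>n. \<forall>x>0. (-1) ^ n * (deriv ^^ n) f x \<ge> 0)"

definition forward_diff :: "real \<Rightarrow> (real \<Rightarrow> real) \<Rightarrow> real \<Rightarrow> real" where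
  "forward_diff c f x = f (x + c) - f x"

definition neg_forward_diff :: "real \<Rightarrow> (real \<Rightarrow> real) \<Rightarrow> real \<Rightarrow> real" where
  "neg_forward_diff c f x = - forward_diff c f x"

text \<open>
  A positive Radon measure on \<open>[0,\<infinity>)\<close> is a Borel measure that is finite on compact sets.
  The Bochner formulation includes that \<open>x \<mapsto> exp (- t x)\<close> is \<open>\<nu>\<close>-integrable.
\<close>

definition laplace_representative :: "real measure \<Rightarrow> (real \<Rightarrow> real) \<Rightarrow> bool" where
  "laplace_representative \<nu> f \<longleftrightarrow>
     sets \<nu> = sets (restrict_space borel {0..}) \<and>
     (\<forall>K. compact K \<and> K \<subseteq> {0..} \<longrightarrow> emeasure \<nu> K < \<infinity>) \<and>
     (\<forall>t>0. has_bochner_integral \<nu> (\<lambda>x. exp (- t * x)) (f t))"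

text \<open>
  The representative measure of a completely monotone function exists and is unique;
  the existential form below asserts the existence.
\<close>

definition cm_diff_without_mass_at_zero :: "real \<Rightarrow> (real \<Rightarrow> real) \<Rightarrow> bool" where
  "cm_diff_without_mass_at_zero c \<Psi> \<longleftrightarrow>
     completely_monotone (neg_forward_diff c \<Psi>) \<and>
     (\<exists>\<nu>. laplace_representative \<nu> (neg_forward_diff c \<Psi>) \<and> emeasure \<nu> {0} = 0)"

definition locally_uniform_limit_pos ::
    "(nat \<Rightarrow> real \<Rightarrow> real) \<Rightarrow> (real \<Rightarrow> real) \<Rightarrow> bool" where
  "locally_uniform_limit_pos F G \<longleftrightarrow>
     (\<forall>K. compact K \<and> K \<subseteq> {0<..} \<longrightarrow> uniform_limit K F G sequentially)"

text \<open>
  The difference condition for a single \<open>c\<close> does not see \<open>c\<close>-periodic summands, so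
  it does not imply complete monotonicity, not even for smooth functions: a limit at
  infinity has to be required as well.
\<close>

lemma single_step_counterexample:
  fixes \<Psi> :: "real \<Rightarrow> real"
  defines "\<Psi> \<equiv> \<lambda>x. 1 + sin (2 * pi * x)"
  shows "\<forall>x. \<Psi> x \<ge> 0" "\<Psi> \<in> borel_measurable borel"
    and "cm_diff_without_mass_at_zero 1 \<Psi>" "\<not> completely_monotone \<Psi>"
proof -
  show "\<forall>x. \<Psi> x \<ge> 0"
  proof
    fix x show "\<Psi> x \<ge> 0"
      using sin_ge_minus_one[of "2 * pi * x"] by (simp add: \<Psi>_def del: sin_ge_minus_one)
  qed
  show "\<Psi> \<in> borel_measurable borel"
    unfolding \<Psi>_def by measurable
  have zero: "neg_forward_diff 1 \<Psi> = (\<lambda>_. 0)"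
    using sin_periodic
    by (auto simp: fun_eq_iff neg_forward_diff_def forward_diff_def \<Psi>_def distrib_left)
  have deriv0: "(deriv ^^ n) (\<lambda>_::real. 0::real) = (\<lambda>_. 0)" for n
    by (induction n) auto
  have "laplace_representative (null_measure (restrict_space borel {0..})) (\<lambda>_. 0)"
  proof -
    have "(\<lambda>x::real. exp (- (t * x))) \<in> borel_measurable (restrict_space borel {0..})" for t
      by (intro measurable_restrict_space1) measurable
    then show ?thesis
      by (auto simp: laplace_representative_def has_bochner_integral_iff
            integrable_iff_bounded nn_integral_null_measure
            integral_null_measure measurable_def)
  qed
  then show "cm_diff_without_mass_at_zero 1 \<Psi>"
    unfolding cm_diff_without_mass_at_zero_def zero
    by (auto simp: completely_monotone_def deriv0 intro!: exI)
  have "(\<Psi> has_field_derivative 2 * pi) (at 1)"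
    unfolding \<Psi>_def by (auto intro!: derivative_eq_intros)
  then have "deriv \<Psi> 1 = 2 * pi"
    by (rule DERIV_imp_deriv)
  then have "\<not> (-1) ^ 1 * (deriv ^^ 1) \<Psi> 1 \<ge> 0"
    using pi_gt_zero by (simp add: not_le)
  then show "\<not> completely_monotone \<Psi>"
    unfolding completely_monotone_def using zero_less_one by blast
qed

end

theory Submission
  imports Defs "HOL-Probability.Probability"
begin

text \<open>
  Write \<open>A\<^sub>n = (-1)\<^sup>n f\<^bsup>(n)\<^esup>\<close>; a smooth \<open>f\<close> is completely monotone iff all \<open>A\<^sub>n\<close> are nonnegative, and
  then all of them decrease, because the derivative of \<open>A\<^sub>n\<close> is \<open>- A\<^bsub>n+1\<^esub>\<close>. Hence the signed
  derivatives \<open>A\<^sub>n(x) - A\<^sub>n(x + c)\<close> of \<open>-\<Delta>\<^sub>c f\<close> are nonnegative as well.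

  From differences to functions. If \<open>f = -\<Delta>\<^sub>c \<Psi>\<close> is completely monotone and \<open>\<Psi>\<close> has the limit \<open>L\<close>
  at infinity, telescoping gives \<open>\<Psi>(x) = L + \<Sum>\<^sub>i f(x + i c)\<close>. The mean value theorem bounds
  \<open>A\<^bsub>n+1\<^esub>(x)\<close> by \<open>(2/x) A\<^sub>n(x/2)\<close>, so all differentiated series converge, and by monotonicity they
  do so uniformly on every half-line away from \<open>0\<close>. Thus \<open>\<Psi>\<close> is completely monotone
  (\<open>completely_monotone_if_diff\<close>). If the hypothesis holds for every \<open>c\<close>, then \<open>\<Psi>\<close> decreases
  and the limit exists automatically.

  From functions to differences. If \<open>\<Psi>(t) = \<integral> exp (- t x) \<mu>(dx)\<close>, then \<open>-\<Delta>\<^sub>c \<Psi>\<close> is represented by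
  the measure with density \<open>1 - exp (- c x)\<close> with respect to \<open>\<mu>\<close>, and this density vanishes at \<open>0\<close>. So
  what is needed is the existence half of Bernstein's theorem (\<open>bernstein_representation\<close>). By
  \<open>cm_family_taylor_sums\<close>, a completely monotone function is on \<open>(0,m)\<close> the sum of its Taylor
  series at \<open>m\<close>, all of whose terms are nonnegative. Evaluated at \<open>m (1 - exp (- s / m))\<close> this series
  is the Laplace transform at \<open>s\<close> of a measure with atoms at the points \<open>k / m\<close>, and its argument tends
  to \<open>s\<close> as \<open>m\<close> grows. Multiplied by \<open>exp (- x)\<close> and normalised, these measures are probability
  laws with a bounded exponential moment; they are tight, and Helly's theorem yields a limit
  law, from which \<open>\<mu>\<close> is recovered by undoing the exponential factor
  (\<open>exists_weak_limit_with_exp_moments\<close>).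

  The convergence in part (b) is that of \<open>A\<^sub>k(t + n c)\<close> to \<open>0\<close> for the function \<open>\<Psi> - L\<close>; it is uniform in
  \<open>t\<close> since \<open>A\<^sub>k\<close> decreases (\<open>completely_monotone_limit_diffs\<close>).
\<close>

section \<open>Sign-corrected derivatives of completely monotone functions\<close>

text \<open>
  The family \<open>A n\<close> plays the role of \<open>(-1)\<^sup>n f\<^bsup>(n)\<^esup>\<close>. Keeping all orders in one object lets inductions
  pass from \<open>A n\<close> to \<open>A (Suc n)\<close>, and complete monotonicity of a function built from others can be
  shown by writing down candidates for its derivatives, without iterating \<^const>\<open>deriv\<close>.
\<close>

definition cm_family :: "(nat \<Rightarrow> real \<Rightarrow> real) \<Rightarrow> bool" where
  "cm_family A \<longleftrightarrow>
     (\<forall>n. \<forall>x>0. A n x \<ge> 0 \<and> (A n has_real_derivative - A (Suc n) x) (at x))"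

definition signed_deriv :: "(real \<Rightarrow> real) \<Rightarrow> nat \<Rightarrow> real \<Rightarrow> real" where
  "signed_deriv f n x = (-1) ^ n * (deriv ^^ n) f x"

lemma cm_family_nonneg: "cm_family A \<Longrightarrow> x > 0 \<Longrightarrow> A n x \<ge> 0"
  by (simp add: cm_family_def)

lemma cm_family_DERIV:
  "cm_family A \<Longrightarrow> x > 0 \<Longrightarrow> (A n has_real_derivative - A (Suc n) x) (at x)"
  by (simp add: cm_family_def)

lemma cm_family_signed_deriv:
  assumes "completely_monotone f"
  shows "cm_family (signed_deriv f)"
proof -
  have "(signed_deriv f n has_real_derivative - signed_deriv f (Suc n) x) (at x)"
    if "x > 0" for n x
  proof -
    have "((deriv ^^ n) f has_real_derivative (deriv ^^ Suc n) f x) (at x)"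
      using assms that by (simp add: completely_monotone_def DERIV_deriv_iff_real_differentiable)
    then have "((\<lambda>x. (-1) ^ n * (deriv ^^ n) f x) has_real_derivative
                 (-1) ^ n * (deriv ^^ Suc n) f x) (at x)"
      by (rule DERIV_cmult)
    then show ?thesis
      by (simp add: signed_deriv_def[abs_def])
  qed
  then show ?thesis
    using assms by (simp add: cm_family_def completely_monotone_def signed_deriv_def)
qed

text \<open>
  The derivative at a point of the open half-line depends only on values nearby, so agreement of
  \<open>f\<close> with \<open>A 0\<close> there propagates to all orders.
\<close>

lemma cm_family_imp_higher_deriv:
  assumes A: "cm_family A" and f: "\<And>x. x > 0 \<Longrightarrow> f x = A 0 x" and "x > 0"
  shows "(deriv ^^ n) f x = (-1) ^ n * A n x"
    and "((deriv ^^ n) f has_real_derivative (-1) ^ Suc n * A (Suc n) x) (at x)"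
proof -
  have DERIV: "((deriv ^^ n) f has_real_derivative (-1) ^ Suc n * A (Suc n) x) (at x)"
    if "\<forall>x>0. (deriv ^^ n) f x = (-1) ^ n * A n x" and "x > 0" for n x
  proof (rule has_field_derivative_transform_within_open)
    have "((\<lambda>x. (-1) ^ n * A n x) has_real_derivative (-1) ^ n * - A (Suc n) x) (at x)"
      using cm_family_DERIV[OF A \<open>x > 0\<close>] by (rule DERIV_cmult)
    then show "((\<lambda>x. (-1) ^ n * A n x) has_real_derivative (-1) ^ Suc n * A (Suc n) x) (at x)"
      by simp
    show "open {0::real<..}" "x \<in> {0<..}"
      using \<open>x > 0\<close> by auto
  qed (use that in auto)
  have eq: "\<forall>x>0. (deriv ^^ n) f x = (-1) ^ n * A n x" for n
    by (induction n) (use f DERIV DERIV_imp_deriv in fastforce)+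
  show "(deriv ^^ n) f x = (-1) ^ n * A n x"
    and "((deriv ^^ n) f has_real_derivative (-1) ^ Suc n * A (Suc n) x) (at x)"
    using eq DERIV \<open>x > 0\<close> by blast+
qed

lemma completely_monotone_if_cm_family:
  assumes A: "cm_family A" and f: "\<And>x. x > 0 \<Longrightarrow> f x = A 0 x"
  shows "completely_monotone f"
  unfolding completely_monotone_def
proof (intro conjI allI impI)
  fix n and x :: real assume x: "x > 0"
  show "(deriv ^^ n) f differentiable (at x)"
    using cm_family_imp_higher_deriv(2)[OF A f x] real_differentiable_def by blast
  show "(-1) ^ n * (deriv ^^ n) f x \<ge> 0"
    using cm_family_nonneg[OF A x, of n]
    by (simp add: cm_family_imp_higher_deriv(1)[OF A f x] mult.assoc[symmetric]
          flip: power_add mult_2)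
qed

lemma cm_family_antimono:
  assumes A: "cm_family A" and xy: "0 < x" "x \<le> y"
  shows "A n y \<le> A n x"
proof (rule DERIV_nonpos_imp_nonincreasing[OF xy(2)])
  fix z assume "x \<le> z" "z \<le> y"
  with xy have "z > 0" by linarith
  then show "\<exists>d. (A n has_real_derivative d) (at z) \<and> d \<le> 0"
    using cm_family_DERIV[OF A] cm_family_nonneg[OF A] by (metis neg_le_0_iff_le)
qed

text \<open>
  Bounds a derivative by an increment of the function one order below, by the mean value theorem
  and because the absolute value of the derivative is smallest at the right end of the interval.
  Summability and decay at infinity are transferred to higher orders in this way.
\<close>

lemma cm_family_Suc_le_difference:
  assumes A: "cm_family A" and "x > 0" "h > 0"
  shows "h * A (Suc n) (x + h) \<le> A n x - A n (x + h)"
proof -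
  have "\<exists>z>x. z < x + h \<and> A n (x + h) - A n x = (x + h - x) * - A (Suc n) z"
    using assms by (intro MVT2 cm_family_DERIV) auto
  then obtain z where z: "x < z" "z < x + h" "A n (x + h) - A n x = h * - A (Suc n) z"
    by auto
  have "h * A (Suc n) (x + h) \<le> h * A (Suc n) z"
    using assms z by (intro mult_left_mono cm_family_antimono[OF A]) auto
  with z(3) show ?thesis by simp
qed

lemma cm_family_diff:
  assumes A: "cm_family A" and "c \<ge> 0"
  shows "cm_family (\<lambda>n x. A n x - A n (x + c))"
  unfolding cm_family_def
proof (intro allI impI conjI)
  fix n and x :: real assume "x > 0"
  then show "A n x - A n (x + c) \<ge> 0"
    using cm_family_antimono[OF A, of x "x + c" n] assms by simp
  have "((\<lambda>x. A n (x + c)) has_real_derivative - A (Suc n) (x + c)) (at x)"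
    using cm_family_DERIV[OF A, of "x + c" n] \<open>x > 0\<close> \<open>c \<ge> 0\<close> by (simp add: DERIV_shift)
  then show "((\<lambda>x. A n x - A n (x + c)) has_real_derivative
                - (A (Suc n) x - A (Suc n) (x + c))) (at x)"
    using DERIV_diff[OF cm_family_DERIV[OF A \<open>x > 0\<close>, of n]] by fastforce
qed

lemma cm_family_add_const:
  assumes A: "cm_family A" and "\<And>x. x > 0 \<Longrightarrow> A 0 x + C \<ge> 0"
  shows "cm_family (\<lambda>n x. A n x + (if n = 0 then C else 0))"
  unfolding cm_family_def
proof (intro allI impI conjI)
  fix n and x :: real assume "x > 0"
  then show "A n x + (if n = 0 then C else 0) \<ge> 0"
    using assms(2)[OF \<open>x > 0\<close>] cm_family_nonneg[OF A \<open>x > 0\<close>, of n] by (cases "n = 0") simp_all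
  show "((\<lambda>x. A n x + (if n = 0 then C else 0)) has_real_derivative
          - (A (Suc n) x + (if Suc n = 0 then C else 0))) (at x)"
    using DERIV_add[OF cm_family_DERIV[OF A \<open>x > 0\<close>, of n] DERIV_const] by simp
qed

section \<open>Limits at infinity and series of shifts\<close>

lemma antimono_nonneg_tendsto:
  fixes f :: "real \<Rightarrow> real"
  assumes nonneg: "\<And>x. x > 0 \<Longrightarrow> f x \<ge> 0"
    and anti: "\<And>x y. 0 < x \<Longrightarrow> x \<le> y \<Longrightarrow> f y \<le> f x"
  obtains L where "(f \<longlongrightarrow> L) at_top" "L \<ge> 0"
proof
  let ?L = "Inf (f ` {0<..})"
  have bdd: "bdd_below (f ` {0<..})"
    using nonneg by (auto intro!: bdd_belowI[of _ 0])
  show "?L \<ge> 0"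
    using nonneg by (intro cInf_greatest) auto
  show "(f \<longlongrightarrow> ?L) at_top"
  proof (rule decreasing_tendsto)
    show "\<forall>\<^sub>F x in at_top. ?L \<le> f x"
      using eventually_gt_at_top[of 0] by eventually_elim (auto intro!: cInf_lower bdd)
  next
    fix b assume "?L < b"
    then obtain x where "x > 0" "f x < b"
      using bdd by (auto simp: cInf_less_iff)
    show "\<forall>\<^sub>F y in at_top. f y < b"
      using eventually_ge_at_top[of x]
    proof eventually_elim
      case (elim y)
      then show ?case using anti[OF \<open>x > 0\<close> elim] \<open>f x < b\<close> by linarith
    qed
  qed
qed

lemma tendsto_shift_at_top:
  fixes f :: "real \<Rightarrow> real"
  assumes "(f \<longlongrightarrow> L) at_top"
  shows "((\<lambda>x. f (x + h)) \<longlongrightarrow> L) at_top"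
  by (rule filterlim_compose[OF assms]) real_asymp

text \<open>
  The function one order below converges, so its increments over steps of length \<open>1\<close> tend to
  zero, and they dominate \<open>A (Suc n)\<close>.
\<close>

lemma cm_family_Suc_tendsto_0:
  assumes A: "cm_family A"
  shows "(A (Suc n) \<longlongrightarrow> 0) at_top"
proof -
  obtain L where L: "(A n \<longlongrightarrow> L) at_top"
    using cm_family_nonneg[OF A] cm_family_antimono[OF A] by (rule antimono_nonneg_tendsto)
  have "((\<lambda>x. A n (x - 1) - A n x) \<longlongrightarrow> L - L) at_top"
    using tendsto_diff[OF tendsto_shift_at_top[OF L, of "-1"] L] by simp
  then have diff: "((\<lambda>x. A n (x - 1) - A n x) \<longlongrightarrow> 0) at_top"
    by simp
  show ?thesis
  proof (rule tendsto_sandwich[OF _ _ tendsto_const diff])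
    show "\<forall>\<^sub>F x in at_top. 0 \<le> A (Suc n) x"
      using eventually_gt_at_top[of 0] by eventually_elim (rule cm_family_nonneg[OF A])
    show "\<forall>\<^sub>F x in at_top. A (Suc n) x \<le> A n (x - 1) - A n x"
      using eventually_gt_at_top[of 1]
      by eventually_elim (use cm_family_Suc_le_difference[OF A, of "_ - 1" 1 n] in force)
  qed
qed

text \<open>
  Summability passes from order \<open>n\<close> at \<open>x / 2\<close> to order \<open>n + 1\<close> at \<open>x\<close>, since half of \<open>x\<close> is
  available as the step in the bound of a derivative by an increment.
\<close>

lemma summable_cm_family_shifts:
  assumes A: "cm_family A"
    and base: "\<And>x. x > 0 \<Longrightarrow> summable (\<lambda>i. A 0 (x + real i * c))" and "c > 0" "x > 0"
  shows "summable (\<lambda>i. A n (x + real i * c))"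
  using \<open>x > 0\<close>
proof (induction n arbitrary: x)
  case (Suc n)
  have "summable (\<lambda>i. (2 / x) * A n (x / 2 + real i * c))"
    using Suc by (intro summable_mult) simp
  then show ?case
  proof (rule summable_comparison_test')
    fix i assume "i \<ge> (0::nat)"
    have pos: "x / 2 + real i * c > 0" "x + real i * c > 0"
      using \<open>c > 0\<close> Suc.prems by (auto intro!: add_pos_nonneg)
    have "x / 2 * A (Suc n) (x + real i * c) \<le> A n (x / 2 + real i * c) - A n (x + real i * c)"
      using cm_family_Suc_le_difference[OF A pos(1), of "x / 2" n] Suc.prems
      by (simp add: algebra_simps)
    also have "\<dots> \<le> A n (x / 2 + real i * c)"
      using cm_family_nonneg[OF A pos(2)] by simp
    finally show "norm (A (Suc n) (x + real i * c)) \<le> (2 / x) * A n (x / 2 + real i * c)"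
      using cm_family_nonneg[OF A pos(2), of "Suc n"] Suc.prems by (simp add: field_simps)
  qed
qed (use base in simp)

text \<open>
  Differentiation under the sum: on \<open>(x/2, \<infinity>)\<close> each differentiated term is dominated by its value at
  \<open>x/2\<close>, so the Weierstrass test applies.
\<close>

lemma cm_family_suminf_shifts:
  assumes A: "cm_family A"
    and base: "\<And>x. x > 0 \<Longrightarrow> summable (\<lambda>i. A 0 (x + real i * c))" and "c > 0"
  shows "cm_family (\<lambda>n x. \<Sum>i. A n (x + real i * c))"
  unfolding cm_family_def
proof (intro allI impI conjI)
  fix n and x :: real assume "x > 0"
  have pos: "y + real i * c > 0" if "y > 0" for y i
    using that \<open>c > 0\<close> by (auto intro!: add_pos_nonneg)
  have summable: "summable (\<lambda>i. A m (y + real i * c))" if "y > 0" for m y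
    by (rule summable_cm_family_shifts[OF A _ \<open>c > 0\<close> that]) (rule base)
  show "(\<Sum>i. A n (x + real i * c)) \<ge> 0"
    using \<open>x > 0\<close> by (intro suminf_nonneg summable cm_family_nonneg[OF A] pos)
  let ?S = "{x / 2<..}"
  have "((\<lambda>x. \<Sum>i. A n (x + real i * c)) has_field_derivative
          (\<Sum>i. - A (Suc n) (x + real i * c))) (at x)"
  proof (rule has_field_derivative_series'(2)[where S = ?S and x0 = x])
    show "((\<lambda>x. A n (x + real i * c)) has_real_derivative - A (Suc n) (y + real i * c))
            (at y within ?S)" if "y \<in> ?S" for i y
    proof -
      have "y > 0" using that \<open>x > 0\<close> by simp
      then show ?thesis
        using cm_family_DERIV[OF A pos[of y i], of n]
        by (auto simp: DERIV_shift intro: has_field_derivative_at_within)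
    qed
    show "uniformly_convergent_on ?S (\<lambda>k y. \<Sum>i<k. - A (Suc n) (y + real i * c))"
    proof (rule Weierstrass_m_test')
      show "summable (\<lambda>i. A (Suc n) (x / 2 + real i * c))"
        using \<open>x > 0\<close> by (intro summable) auto
      show "norm (- A (Suc n) (y + real i * c)) \<le> A (Suc n) (x / 2 + real i * c)"
        if "y \<in> ?S" for y i
        using that \<open>x > 0\<close> cm_family_nonneg[OF A pos[of y i], of "Suc n"]
          cm_family_antimono[OF A pos[of "x / 2" i], of "y + real i * c" "Suc n"]
        by simp
    qed
    show "summable (\<lambda>i. A n (x + real i * c))"
      using \<open>x > 0\<close> by (rule summable)
  qed (use \<open>x > 0\<close> in \<open>auto simp: interior_open\<close>)
  then show "((\<lambda>x. \<Sum>i. A n (x + real i * c)) has_field_derivative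
          - (\<Sum>i. A (Suc n) (x + real i * c))) (at x)"
    using suminf_minus[OF summable[OF \<open>x > 0\<close>]] by simp
qed

text \<open>
  The increments over steps \<open>c\<close> telescope to \<open>\<Psi> - L\<close>. The limit at infinity is what excludes
  \<open>c\<close>-periodic summands of \<open>\<Psi>\<close>.
\<close>

lemma completely_monotone_if_diff:
  assumes nonneg: "\<And>x. x > 0 \<Longrightarrow> \<Psi> x \<ge> 0" and lim: "(\<Psi> \<longlongrightarrow> L) at_top"
    and cm: "completely_monotone (neg_forward_diff c \<Psi>)" and "c > 0"
  shows "completely_monotone \<Psi>"
proof -
  let ?A = "signed_deriv (neg_forward_diff c \<Psi>)"
  let ?B = "\<lambda>n x. \<Sum>i. ?A n (x + real i * c)"
  have A: "cm_family ?A"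
    using cm by (rule cm_family_signed_deriv)
  have sums: "(\<lambda>i. ?A 0 (x + real i * c)) sums (\<Psi> x - L)" if "x > 0" for x
  proof -
    have "?A 0 (x + real i * c) = \<Psi> (x + real i * c) - \<Psi> (x + real (Suc i) * c)" for i
      by (simp add: signed_deriv_def neg_forward_diff_def forward_diff_def algebra_simps)
    moreover have "(\<lambda>i. \<Psi> (x + real i * c)) \<longlonglongrightarrow> L"
      using \<open>c > 0\<close> by (intro filterlim_compose[OF lim]) real_asymp
    ultimately show ?thesis
      using telescope_sums'[of "\<lambda>i. \<Psi> (x + real i * c)" L] by simp
  qed
  have B: "cm_family ?B"
    using sums by (intro cm_family_suminf_shifts A \<open>c > 0\<close>) (auto simp: sums_iff)
  have "L \<ge> 0"
    by (rule tendsto_lowerbound[OF lim])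
      (auto intro: eventually_mono[OF eventually_gt_at_top[of 0]] nonneg)
  have "cm_family (\<lambda>n x. ?B n x + (if n = 0 then L else 0))"
    using \<open>L \<ge> 0\<close> by (intro cm_family_add_const[OF B] add_nonneg_nonneg cm_family_nonneg[OF B])
  then show ?thesis
    by (rule completely_monotone_if_cm_family) (use sums in \<open>auto simp: sums_iff\<close>)
qed

section \<open>Convergence of the differences\<close>

lemma completely_monotone_neg_forward_diff:
  assumes "completely_monotone f" "c \<ge> 0"
  shows "completely_monotone (neg_forward_diff c f)"
  by (rule completely_monotone_if_cm_family
        [OF cm_family_diff[OF cm_family_signed_deriv[OF assms(1)] assms(2)]])
    (simp add: neg_forward_diff_def forward_diff_def signed_deriv_def)

text \<open>
  As \<open>A k\<close> decreases, \<open>A k (t + n c)\<close> is at most \<open>A k (n c)\<close>, which does not involve \<open>t\<close>.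
\<close>

lemma locally_uniform_limit_shift_decay:
  assumes A: "cm_family A" and lim: "(A k \<longlongrightarrow> 0) at_top" and "c > 0"
  shows "locally_uniform_limit_pos (\<lambda>n t. A k t - A k (t + real n * c)) (A k)"
  unfolding locally_uniform_limit_pos_def
proof (intro allI impI)
  fix K :: "real set" assume K: "compact K \<and> K \<subseteq> {0<..}"
  show "uniform_limit K (\<lambda>n t. A k t - A k (t + real n * c)) (A k) sequentially"
  proof (rule uniform_limitI)
    fix e :: real assume "e > 0"
    have "(\<lambda>n. A k (real n * c)) \<longlonglongrightarrow> 0"
      using \<open>c > 0\<close> by (intro filterlim_compose[OF lim]) real_asymp
    then have "\<forall>\<^sub>F n in sequentially. A k (real n * c) < e"
      using \<open>e > 0\<close> by (rule order_tendstoD)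
    then show "\<forall>\<^sub>F n in sequentially. \<forall>t\<in>K. dist (A k t - A k (t + real n * c)) (A k t) < e"
      using eventually_gt_at_top[of 0]
    proof eventually_elim
      case (elim n)
      then have pos: "real n * c > 0" using \<open>c > 0\<close> by simp
      show ?case
      proof
        fix t assume "t \<in> K"
        with K have "t > 0" by auto
        then show "dist (A k t - A k (t + real n * c)) (A k t) < e"
          using cm_family_nonneg[OF A, of "t + real n * c" k] pos elim(1)
            cm_family_antimono[OF A pos, of "t + real n * c" k]
          by (simp add: dist_real_def)
      qed
    qed
  qed
qed

text \<open>
  Subtracting \<open>L\<close> changes only the term of order \<open>0\<close> of the family, and afterwards every order
  tends to \<open>0\<close> at infinity. The differences of \<open>\<Psi>\<close> and of \<open>\<Psi> - L\<close> are the same.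
\<close>

lemma completely_monotone_limit_diffs:
  assumes cm: "completely_monotone \<Psi>" and lim: "(\<Psi> \<longlongrightarrow> L) at_top"
  shows "completely_monotone (\<lambda>t. \<Psi> t - L)"
    and "c > 0 \<Longrightarrow> t > 0 \<Longrightarrow>
      (\<lambda>n. (deriv ^^ k) (neg_forward_diff (real n * c) \<Psi>) t) \<longlonglongrightarrow> (deriv ^^ k) (\<lambda>t. \<Psi> t - L) t"
    and "c > 0 \<Longrightarrow> locally_uniform_limit_pos
      (\<lambda>n. (deriv ^^ k) (neg_forward_diff (real n * c) \<Psi>)) ((deriv ^^ k) (\<lambda>t. \<Psi> t - L))"
proof -
  let ?A = "signed_deriv \<Psi>"
  define B where "B n x = ?A n x + (if n = 0 then - L else 0)" for n x
  have A: "cm_family ?A"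
    using cm by (rule cm_family_signed_deriv)
  have B0: "B 0 x = \<Psi> x - L" for x
    by (simp add: B_def signed_deriv_def)
  have lim0: "(B n \<longlongrightarrow> 0) at_top" for n
    using cm_family_Suc_tendsto_0[OF A] tendsto_diff[OF lim tendsto_const, of L]
    by (cases n) (simp_all add: B_def[abs_def] signed_deriv_def[of _ 0])
  have "?A 0 x + - L \<ge> 0" if "x > 0" for x
  proof -
    have "L \<le> \<Psi> x"
    proof (rule tendsto_upperbound[OF lim])
      show "\<forall>\<^sub>F y in at_top. \<Psi> y \<le> \<Psi> x"
        using eventually_ge_at_top[of x]
      proof eventually_elim
        case (elim y)
        then show ?case
          using cm_family_antimono[OF A \<open>x > 0\<close> elim, of 0] by (simp add: signed_deriv_def)
      qed
    qed auto
    then show ?thesis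
      by (simp add: signed_deriv_def)
  qed
  then have B: "cm_family B"
    unfolding B_def[abs_def] by (rule cm_family_add_const[OF A])
  show "completely_monotone (\<lambda>t. \<Psi> t - L)"
    using B by (rule completely_monotone_if_cm_family) (simp add: B0)
  have derivG: "(deriv ^^ k) (\<lambda>t. \<Psi> t - L) t = (-1) ^ k * B k t" if "t > 0" for t
    using B by (rule cm_family_imp_higher_deriv) (use that in \<open>simp_all add: B0\<close>)
  have derivD: "(deriv ^^ k) (neg_forward_diff (real n * c) \<Psi>) t
      = (-1) ^ k * (B k t - B k (t + real n * c))" if "t > 0" "c > 0" for t n c
    by (rule cm_family_imp_higher_deriv(1)[OF cm_family_diff[OF B]])
      (use that in \<open>simp_all add: B0 neg_forward_diff_def forward_diff_def\<close>)
  show unif: "locally_uniform_limit_pos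
      (\<lambda>n. (deriv ^^ k) (neg_forward_diff (real n * c) \<Psi>)) ((deriv ^^ k) (\<lambda>t. \<Psi> t - L))"
    if "c > 0" for c
    unfolding locally_uniform_limit_pos_def
  proof (intro allI impI)
    fix K :: "real set" assume K: "compact K \<and> K \<subseteq> {0<..}"
    then have lim: "uniform_limit K (\<lambda>n t. B k t - B k (t + real n * c)) (B k) sequentially"
      using locally_uniform_limit_shift_decay[OF B lim0 \<open>c > 0\<close>]
      by (simp add: locally_uniform_limit_pos_def)
    have "uniform_limit K (\<lambda>n t. (-1) ^ k * (B k t - B k (t + real n * c)))
            (\<lambda>t. (-1) ^ k * B k t) sequentially"
      by (rule bounded_linear.uniform_limit[OF bounded_linear_mult_right lim])
    then show "uniform_limit K (\<lambda>n. (deriv ^^ k) (neg_forward_diff (real n * c) \<Psi>))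
        ((deriv ^^ k) (\<lambda>t. \<Psi> t - L)) sequentially"
      by (rule uniform_limit_cong'[THEN iffD1, rotated 2])
        (use K \<open>c > 0\<close> in \<open>auto simp: derivG derivD\<close>)
  qed
  show "(\<lambda>n. (deriv ^^ k) (neg_forward_diff (real n * c) \<Psi>) t) \<longlonglongrightarrow> (deriv ^^ k) (\<lambda>t. \<Psi> t - L) t"
    if "c > 0" "t > 0"
    using unif[OF \<open>c > 0\<close>, unfolded locally_uniform_limit_pos_def, rule_format, of "{t}"]
      \<open>t > 0\<close> by simp
qed

section \<open>Convergence of the Taylor series\<close>

text \<open>
  The remainder of order \<open>n\<close> at \<open>x\<close> of the expansion about \<open>a\<close>, for the function \<open>A j\<close>; the signs
  \<open>(-1)\<^sup>k\<close> of the derivatives are absorbed into the powers of \<open>a - x\<close>. The index \<open>j\<close> is kept because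
  differentiating lowers \<open>n\<close> by one while raising \<open>j\<close> by one.
\<close>

definition taylor_remainder :: "(nat \<Rightarrow> real \<Rightarrow> real) \<Rightarrow> real \<Rightarrow> nat \<Rightarrow> nat \<Rightarrow> real \<Rightarrow> real" where
  "taylor_remainder A a n j x = A j x - (\<Sum>k<n. A (j + k) a * (a - x) ^ k / fact k)"

lemma taylor_remainder_0 [simp]: "taylor_remainder A a 0 j x = A j x"
  by (simp add: taylor_remainder_def)

lemma taylor_remainder_Suc_at_base [simp]: "taylor_remainder A a (Suc n) j a = 0"
  by (simp add: taylor_remainder_def sum.lessThan_Suc_shift del: sum.lessThan_Suc)

lemma DERIV_power_Suc_reflect:
  "((\<lambda>x::real. (a - x) ^ Suc k) has_real_derivative - (real (Suc k) * (a - x) ^ k)) (at x)"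
proof -
  have "((\<lambda>x. a - x) has_real_derivative - 1) (at x)"
    by (auto intro!: derivative_eq_intros)
  from DERIV_power_Suc[OF this, of k] show ?thesis
    by simp
qed

lemma DERIV_taylor_remainder_Suc:
  assumes A: "cm_family A" and x: "x > 0"
  shows "(taylor_remainder A a (Suc n) j has_real_derivative - taylor_remainder A a n (Suc j) x) (at x)"
proof -
  have "((\<lambda>x. \<Sum>k<n. A (j + Suc k) a * (a - x) ^ Suc k / fact (Suc k)) has_real_derivative
          (\<Sum>k<n. - (A (Suc j + k) a * (a - x) ^ k / fact k))) (at x)"
  proof (rule DERIV_sum)
    fix k
    have "((\<lambda>x. A (j + Suc k) a * (a - x) ^ Suc k / fact (Suc k)) has_real_derivative
           A (j + Suc k) a * - (real (Suc k) * (a - x) ^ k) / fact (Suc k)) (at x)"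
      by (intro DERIV_cdivide DERIV_cmult DERIV_power_Suc_reflect)
    then show "((\<lambda>x. A (j + Suc k) a * (a - x) ^ Suc k / fact (Suc k)) has_real_derivative
          - (A (Suc j + k) a * (a - x) ^ k / fact k)) (at x)"
      by (simp add: field_simps del: of_nat_Suc)
  qed
  from DERIV_diff[OF DERIV_diff[OF cm_family_DERIV[OF A x, of j] DERIV_const[of "A j a"]] this]
  show ?thesis
    by (simp add: taylor_remainder_def[abs_def] sum.lessThan_Suc_shift sum_negf diff_diff_eq
        del: sum.lessThan_Suc)
qed

text \<open>
  A remainder of positive order vanishes at \<open>a\<close> and has minus a remainder of the next lower
  order as its derivative, so it decreases on \<open>(0,a]\<close>.
\<close>

lemma taylor_remainder_nonneg:
  assumes A: "cm_family A" and "0 < x" "x \<le> a"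
  shows "taylor_remainder A a n j x \<ge> 0"
  using assms(2,3)
proof (induction n arbitrary: j x)
  case 0
  then show ?case using cm_family_nonneg[OF A] by simp
next
  case (Suc n)
  have "taylor_remainder A a (Suc n) j a \<le> taylor_remainder A a (Suc n) j x"
  proof (rule DERIV_nonpos_imp_nonincreasing[OF Suc.prems(2)])
    fix y assume "x \<le> y" "y \<le> a"
    then show "\<exists>d. (taylor_remainder A a (Suc n) j has_real_derivative d) (at y) \<and> d \<le> 0"
      using DERIV_taylor_remainder_Suc[OF A, of y a n j] Suc.IH[of y "Suc j"] Suc.prems by auto
  qed
  then show ?case by simp
qed

text \<open>
  With \<open>h = a - x\<close> and \<open>R\<close> for the remainder of order \<open>n + 1\<close> as a function of \<open>h\<close>, this says
  \<open>(n + 1) R(h) \<le> h R'(h)\<close>: the remainder grows at least like \<open>h\<^bsup>n+1\<^esup>\<close>. The difference of the two sides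
  is zero at \<open>x = a\<close>, and its derivative is, up to sign, the same difference for \<open>n - 1\<close> and
  \<open>j + 1\<close>, so induction on \<open>n\<close> applies.
\<close>

lemma taylor_remainder_growth:
  assumes A: "cm_family A" and "0 < x" "x \<le> a"
  shows "real (Suc n) * taylor_remainder A a (Suc n) j x \<le> (a - x) * taylor_remainder A a n (Suc j) x"
  using assms(2,3)
proof (induction n arbitrary: j x)
  case (0 j x)
  let ?S = "\<lambda>x. (a - x) * A (Suc j) x - taylor_remainder A a (Suc 0) j x"
  have "?S a \<le> ?S x"
  proof (rule DERIV_nonpos_imp_nonincreasing[OF 0(2)])
    fix y assume y: "x \<le> y" "y \<le> a"
    with 0 have "y > 0" by simp
    have "(?S has_real_derivative (- 1 * A (Suc j) y + (a - y) * - A (Suc (Suc j)) y + A (Suc j) y)) (at y)"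
      by (auto intro!: derivative_eq_intros cm_family_DERIV[OF A \<open>y > 0\<close>]
          DERIV_taylor_remainder_Suc[OF A \<open>y > 0\<close>])
    moreover have "(a - y) * A (Suc (Suc j)) y \<ge> 0"
      using y cm_family_nonneg[OF A \<open>y > 0\<close>] by simp
    ultimately show "\<exists>d. (?S has_real_derivative d) (at y) \<and> d \<le> 0"
      by fastforce
  qed
  then show ?case by simp
next
  case (Suc n j x)
  let ?S = "\<lambda>x. (a - x) * taylor_remainder A a (Suc n) (Suc j) x
              - real (Suc (Suc n)) * taylor_remainder A a (Suc (Suc n)) j x"
  have "?S a \<le> ?S x"
  proof (rule DERIV_nonpos_imp_nonincreasing[OF Suc.prems(2)])
    fix y assume y: "x \<le> y" "y \<le> a"
    with Suc.prems have "y > 0" by simp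
    let ?d = "- 1 * taylor_remainder A a (Suc n) (Suc j) y
        + (a - y) * - taylor_remainder A a n (Suc (Suc j)) y
        + real (Suc (Suc n)) * taylor_remainder A a (Suc n) (Suc j) y"
    have "(?S has_real_derivative ?d) (at y)"
      by (auto intro!: derivative_eq_intros DERIV_taylor_remainder_Suc[OF A \<open>y > 0\<close>])
    moreover have "?d \<le> 0"
      using Suc.IH[OF \<open>y > 0\<close> y(2), of "Suc j"] by (simp add: algebra_simps)
    ultimately show "\<exists>d. (?S has_real_derivative d) (at y) \<and> d \<le> 0"
      by blast
  qed
  then show ?case by simp
qed

lemma taylor_remainder_quotient_antimono:
  assumes A: "cm_family A" and "0 < y" "y \<le> x" "x < a"
  shows "taylor_remainder A a n j x / (a - x) ^ n \<le> taylor_remainder A a n j y / (a - y) ^ n"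
proof (cases n)
  case 0
  then show ?thesis using cm_family_antimono[OF A \<open>0 < y\<close> \<open>y \<le> x\<close>] by simp
next
  case (Suc m)
  show ?thesis
    unfolding Suc
  proof (rule DERIV_nonpos_imp_nonincreasing[OF \<open>y \<le> x\<close>])
    fix z assume z: "y \<le> z" "z \<le> x"
    with assms have "z > 0" "a - z > 0" by simp_all
    let ?R = "taylor_remainder A a"
    let ?d = "(- ?R m (Suc j) z * (a - z) ^ Suc m - ?R (Suc m) j z * - (real (Suc m) * (a - z) ^ m))
                / ((a - z) ^ Suc m * (a - z) ^ Suc m)"
    have "((\<lambda>x. ?R (Suc m) j x / (a - x) ^ Suc m) has_real_derivative ?d) (at z)"
      using \<open>a - z > 0\<close>
      by (intro DERIV_divide[OF DERIV_taylor_remainder_Suc[OF A \<open>z > 0\<close>] DERIV_power_Suc_reflect])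
        auto
    moreover have "?d \<le> 0"
    proof (intro divide_nonpos_nonneg zero_le_square)
      have "- ?R m (Suc j) z * (a - z) ^ Suc m - ?R (Suc m) j z * - (real (Suc m) * (a - z) ^ m)
          = - ((a - z) ^ m * ((a - z) * ?R m (Suc j) z - real (Suc m) * ?R (Suc m) j z))"
        by (simp add: algebra_simps)
      also have "\<dots> \<le> 0"
        using taylor_remainder_growth[OF A \<open>z > 0\<close>, of a m j] \<open>a - z > 0\<close> by simp
      finally show "- ?R m (Suc j) z * (a - z) ^ Suc m
          - ?R (Suc m) j z * - (real (Suc m) * (a - z) ^ m) \<le> 0" .
    qed
    ultimately show "\<exists>d. ((\<lambda>x. ?R (Suc m) j x / (a - x) ^ Suc m) has_real_derivative d) (at z) \<and> d \<le> 0"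
      by blast
  qed
qed

text \<open>
  This is Bernstein's theorem on absolutely monotone functions. A direct estimate of the
  Lagrange remainder yields convergence only for \<open>x > a / 2\<close>. The monotone quotient of remainder and power compares the
  remainder at \<open>x\<close> with that at a point \<open>y < x\<close>, where it is at most \<open>A 0 y\<close>; this gains the factor
  \<open>((a - x) / (a - y))\<^sup>n\<close> for every \<open>x\<close> in \<open>(0,a)\<close>.
\<close>

theorem cm_family_taylor_sums:
  assumes A: "cm_family A" and x: "0 < x" "x < a"
  shows "(\<lambda>k. A k a * (a - x) ^ k / fact k) sums A 0 x"
proof -
  define y where "y = x / 2"
  define q where "q = (a - x) / (a - y)"
  have y: "0 < y" "y < x" and q: "0 < q" "q < 1"
    using x by (auto simp: y_def q_def)
  have "(\<lambda>n. taylor_remainder A a n 0 x) \<longlonglongrightarrow> 0"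
  proof (rule tendsto_sandwich[OF _ _ tendsto_const])
    show "\<forall>\<^sub>F n in sequentially. 0 \<le> taylor_remainder A a n 0 x"
      using x by (intro always_eventually allI taylor_remainder_nonneg[OF A]) auto
    show "\<forall>\<^sub>F n in sequentially. taylor_remainder A a n 0 x \<le> q ^ n * A 0 y"
    proof (intro always_eventually allI)
      fix n
      have "taylor_remainder A a n 0 x \<le> q ^ n * taylor_remainder A a n 0 y"
        using taylor_remainder_quotient_antimono[OF A y(1), of x a n 0] x y
        by (simp add: q_def power_divide field_simps)
      moreover have "taylor_remainder A a n 0 y \<le> A 0 y"
        unfolding taylor_remainder_def using x y
        by (auto intro!: sum_nonneg divide_nonneg_nonneg mult_nonneg_nonneg cm_family_nonneg[OF A])
      ultimately show "taylor_remainder A a n 0 x \<le> q ^ n * A 0 y"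
        using q by (meson less_imp_le mult_left_mono order_trans zero_le_power)
    qed
    show "(\<lambda>n. q ^ n * A 0 y) \<longlonglongrightarrow> 0"
      using q by (intro tendsto_mult_left_zero LIMSEQ_power_zero) auto
  qed
  then have "(\<lambda>n. A 0 x - taylor_remainder A a n 0 x) \<longlonglongrightarrow> A 0 x - 0"
    by (intro tendsto_intros)
  then show ?thesis
    by (simp add: sums_def taylor_remainder_def)
qed

section \<open>Approximating laws and their weak limits\<close>

text \<open>
  The Taylor series about \<open>m\<close> at the point \<open>m (1 - exp (- t / m))\<close> has the terms
  \<open>A k m * m\<^sup>k / fact k * exp (- t * (k / m))\<close>: it is the Laplace transform at \<open>t\<close> of a measure with
  atoms at \<open>k / m\<close>. The law \<open>P\<close> is this measure times \<open>exp (- x)\<close>, normalised. The exponential factor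
  makes the total mass finite although \<open>A 0\<close> may be unbounded near \<open>0\<close>, and shifts the range
  \<open>t > 0\<close> to \<open>s = t - 1 > - 1\<close>.
\<close>

lemma tilted_taylor_law:
  assumes A: "cm_family A" and pos: "\<And>x. x > 0 \<Longrightarrow> A 0 x > 0" and "m > 0"
  obtains P where "real_distribution P" "AE x in P. x \<ge> 0"
    "\<And>s. s > -1 \<Longrightarrow> has_bochner_integral P (\<lambda>x. exp (- s * x))
       (A 0 (m * (1 - exp (- (s + 1) / m))) / A 0 (m * (1 - exp (- 1 / m))))"
proof -
  define p where "p k = A k m * (m * exp (- 1 / m)) ^ k / fact k / A 0 (m * (1 - exp (- 1 / m)))" for k
  have arg: "0 < m * (1 - exp (- t / m))" "m * (1 - exp (- t / m)) < m" if "t > 0" for t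
    using that \<open>m > 0\<close> by (auto simp: field_simps)
  have sums: "(\<lambda>k. p k * exp (- s * (real k / m))) sums
      (A 0 (m * (1 - exp (- (s + 1) / m))) / A 0 (m * (1 - exp (- 1 / m))))" if "s > -1" for s
  proof -
    have eq: "(m * exp (- 1 / m)) ^ k * exp (- s * (real k / m)) = (m * exp (- (s + 1) / m)) ^ k" for k
    proof -
      have "real k * (- 1 / m) + - s * (real k / m) = real k * (- (s + 1) / m)"
        using \<open>m > 0\<close> by (simp add: field_simps)
      then have "exp (- 1 / m) ^ k * exp (- s * (real k / m)) = exp (- (s + 1) / m) ^ k"
        by (simp only: flip: exp_of_nat_mult exp_add)
      then show ?thesis
        by (simp add: power_mult_distrib)
    qed
    have "m - m * (1 - exp (- (s + 1) / m)) = m * exp (- (s + 1) / m)" "s + 1 > 0"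
      using that by (simp_all add: algebra_simps)
    with cm_family_taylor_sums[OF A arg, of "s + 1"]
    have "(\<lambda>k. A k m * (m * exp (- (s + 1) / m)) ^ k / fact k) sums
            A 0 (m * (1 - exp (- (s + 1) / m)))"
      by (simp only:)
    then have "(\<lambda>k. A k m * ((m * exp (- 1 / m)) ^ k * exp (- s * (real k / m))) / fact k) sums
            A 0 (m * (1 - exp (- (s + 1) / m)))"
      by (simp only: eq)
    from sums_divide[OF this, of "A 0 (m * (1 - exp (- 1 / m)))"]
    show ?thesis
      by (simp add: p_def mult_ac)
  qed
  have p: "p k \<ge> 0" for k
    using \<open>m > 0\<close> pos[OF arg(1), of 1] cm_family_nonneg[OF A \<open>m > 0\<close>] by (simp add: p_def)
  have p_prob: "(\<integral>\<^sup>+k. ennreal (p k) \<partial>count_space UNIV) = 1"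
    using sums[of 0] pos[OF arg(1), of 1]
    by (simp add: nn_integral_count_space_nat suminf_ennreal_eq[OF p])
  define P where "P = distr (embed_pmf p) borel (\<lambda>k. real k / m)"
  show thesis
  proof
    show "real_distribution P"
      unfolding P_def by (intro prob_space.real_distribution_distr prob_space_measure_pmf) simp
    show "AE x in P. x \<ge> 0"
      unfolding P_def using \<open>m > 0\<close> by (subst AE_distr_iff) auto
    show "has_bochner_integral P (\<lambda>x. exp (- s * x))
       (A 0 (m * (1 - exp (- (s + 1) / m))) / A 0 (m * (1 - exp (- 1 / m))))" if "s > -1" for s
    proof -
      have "(\<integral>\<^sup>+x. ennreal (exp (- s * x)) \<partial>P)
          = (\<Sum>k. ennreal (p k) * ennreal (exp (- s * (real k / m))))"
        unfolding P_def
        by (simp add: nn_integral_distr nn_integral_measure_pmf pmf_embed_pmf[OF p p_prob]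
            nn_integral_count_space_nat)
      also have "\<dots> = (\<Sum>k. ennreal (p k * exp (- s * (real k / m))))"
        using p by (simp add: ennreal_mult')
      also have "\<dots> = ennreal (A 0 (m * (1 - exp (- (s + 1) / m))) / A 0 (m * (1 - exp (- 1 / m))))"
        using p by (intro suminf_ennreal_eq sums that) simp
      finally show ?thesis
        using that \<open>m > 0\<close>
        by (intro has_bochner_integral_nn_integral less_imp_le[OF divide_pos_pos] pos arg(1))
          (simp_all add: P_def)
    qed
  qed
qed


text \<open>
  Markov's inequality for \<open>exp (s x)\<close> bounds the upper tails uniformly; nonnegativity takes care of the
  lower tails.
\<close>

lemma tight_if_exp_moment_bounded:
  fixes P :: "nat \<Rightarrow> real measure"
  assumes rd: "\<And>n. real_distribution (P n)" and nonneg: "\<And>n. AE x in P n. x \<ge> 0"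
    and "s > 0" and moment: "\<And>n. has_bochner_integral (P n) (\<lambda>x. exp (s * x)) (c n)"
    and bounded: "\<And>n. c n \<le> C"
  shows "tight P"
  unfolding tight_def
proof (intro conjI allI impI)
  fix \<epsilon> :: real assume "\<epsilon> > 0"
  have "((\<lambda>b. exp (- s * b) * C) \<longlongrightarrow> 0) at_top"
    using \<open>s > 0\<close> by real_asymp
  then have "\<forall>\<^sub>F b in at_top. exp (- s * b) * C < \<epsilon> \<and> -1 < b"
    using \<open>\<epsilon> > 0\<close> by (intro eventually_conj order_tendstoD eventually_gt_at_top)
  then obtain b where b: "exp (- s * b) * C < \<epsilon>" "-1 < b"
    using eventually_happens'[OF trivial_limit_at_top_linorder] by blast
  have "measure (P n) {-1<..b} > 1 - \<epsilon>" for n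
  proof -
    interpret real_distribution "P n" by (rule rd)
    have "prob (UNIV - {-1<..b}) = (\<integral>x. indicator (UNIV - {-1<..b}) x \<partial>P n)"
      by simp
    also have "\<dots> \<le> (\<integral>x. exp (- s * b) * exp (s * x) \<partial>P n)"
    proof (rule integral_mono_AE)
      show "integrable (P n) (indicator (UNIV - {-1<..b}) :: real \<Rightarrow> real)"
        by (intro integrable_const_bound[where B = 1]) (auto simp: indicator_def)
      show "integrable (P n) (\<lambda>x. exp (- s * b) * exp (s * x))"
        using moment[of n] by (simp add: has_bochner_integral_iff)
      show "AE x in P n. indicator (UNIV - {-1<..b}) x \<le> exp (- s * b) * exp (s * x)"
        using nonneg[of n]
      proof eventually_elim
        case (elim x)
        have "s * b \<le> s * x" if "b < x"
          using \<open>s > 0\<close> that by simp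
        with elim show ?case
          by (auto simp: indicator_def simp flip: exp_add)
      qed
    qed
    also have "\<dots> = exp (- s * b) * c n"
      using moment[of n] by (simp add: has_bochner_integral_iff)
    also have "\<dots> \<le> exp (- s * b) * C"
      using bounded by (intro mult_left_mono) auto
    also have "\<dots> < \<epsilon>"
      by (rule b)
    finally show ?thesis
      using prob_compl[of "{-1<..b}"] by (simp add: Compl_eq_Diff_UNIV)
  qed
  with b(2) show "\<exists>a b. a < b \<and> (\<forall>n. 1 - \<epsilon> < measure (P n) {a<..b})"
    by blast
qed (rule rd)

text \<open>
  The truncated negative part of \<open>x\<close> is bounded and continuous, so its vanishing integral passes to
  the limit.
\<close>

lemma weak_conv_AE_nonneg:
  assumes rd: "\<And>n. real_distribution (P n)" "real_distribution M" and conv: "weak_conv_m P M"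
    and nonneg: "\<And>n. AE x in P n. x \<ge> 0"
  shows "AE x in M. x \<ge> 0"
proof -
  interpret real_distribution M by (rule rd)
  let ?f = "\<lambda>x::real. min 1 (max 0 (- x))"
  have "(\<lambda>n. integral\<^sup>L (P n) ?f) \<longlonglongrightarrow> integral\<^sup>L M ?f"
    by (rule weak_conv_imp_integral_bdd_continuous_conv[OF rd conv, where B = 1])
      (auto intro!: continuous_intros)
  moreover have "integral\<^sup>L (P n) ?f = 0" for n
    using nonneg[of n] by (intro integral_eq_zero_AE) (auto elim!: eventually_mono)
  ultimately have "integral\<^sup>L M ?f = 0"
    by (simp add: LIMSEQ_const_iff)
  moreover have "integrable M ?f"
    by (intro integrable_const_bound[where B = 1]) auto
  ultimately have "AE x in M. ?f x = 0"
    by (subst (asm) integral_nonneg_eq_0_iff_AE) auto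
  then show ?thesis
    by eventually_elim (auto simp: min_def max_def split: if_splits)
qed

text \<open>
  The exponential is unbounded and weak convergence does not apply to it directly, so it is
  truncated at the level \<open>exp k\<close>. A moment with the exponent \<open>(1 + \<delta>) s\<close> makes the truncation
  error at most a constant times \<open>exp (- \<delta> k)\<close>, uniformly in \<open>n\<close>, and monotone convergence removes
  the truncation in the limit law.
\<close>

lemma weak_conv_exp_moment:
  assumes rd: "\<And>n. real_distribution (P n)" "real_distribution M" and conv: "weak_conv_m P M"
    and "\<delta> > 0"
    and mom: "\<And>n. has_bochner_integral (P n) (\<lambda>x. exp (- s * x)) (c n)" "c \<longlonglongrightarrow> C"
    and mom': "\<And>n. has_bochner_integral (P n) (\<lambda>x. exp (- ((1 + \<delta>) * s) * x)) (d n)" "d \<longlonglongrightarrow> D"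
  shows "has_bochner_integral M (\<lambda>x. exp (- s * x)) C"
proof -
  interpret M: real_distribution M by (rule rd)
  let ?g = "\<lambda>k x. min (exp (- s * x)) (exp (real k))"
  have g_int: "integrable N (?g k)" if "real_distribution N" for k and N :: "real measure"
  proof -
    interpret real_distribution N by (rule that)
    show ?thesis
      by (intro integrable_const_bound[where B = "exp (real k)"]) auto
  qed
  have lim: "(\<lambda>n. integral\<^sup>L (P n) (?g k)) \<longlonglongrightarrow> integral\<^sup>L M (?g k)" for k
    by (rule weak_conv_imp_integral_bdd_continuous_conv[OF rd conv, where B = "exp (real k)"])
      (auto intro!: continuous_intros)
  have upper: "integral\<^sup>L (P n) (?g k) \<le> c n" for n k
    using integral_mono[OF g_int[OF rd(1)], of n "\<lambda>x. exp (- s * x)" k] mom(1)[of n]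
    by (simp add: has_bochner_integral_iff)
  have lower: "c n - exp (- \<delta> * real k) * d n \<le> integral\<^sup>L (P n) (?g k)" for n k
  proof -
    have "c n \<le> (\<integral>x. ?g k x + exp (- \<delta> * real k) * exp (- ((1 + \<delta>) * s) * x) \<partial>P n)"
      unfolding has_bochner_integral_integral_eq[OF mom(1), symmetric]
    proof (rule integral_mono)
      fix x
      show "exp (- s * x) \<le> ?g k x + exp (- \<delta> * real k) * exp (- ((1 + \<delta>) * s) * x)"
      proof (cases "- s * x \<le> real k")
        case False
        then have "\<delta> * (- s * x - real k) \<ge> 0"
          using \<open>\<delta> > 0\<close> by simp
        then have "exp (- s * x) \<le> exp (- \<delta> * real k + - ((1 + \<delta>) * s) * x)"
          by (simp add: algebra_simps)
        then show ?thesis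
          unfolding exp_add by (intro add_increasing) simp_all
      qed simp
    qed (use mom(1) mom'(1) g_int[OF rd(1)] in \<open>auto simp: has_bochner_integral_iff\<close>)
    also have "\<dots> = integral\<^sup>L (P n) (?g k) + exp (- \<delta> * real k) * d n"
      using mom'(1)[of n] g_int[OF rd(1)] by (simp add: has_bochner_integral_iff)
    finally show ?thesis by simp
  qed
  have lower': "C - exp (- \<delta> * real k) * D \<le> integral\<^sup>L M (?g k)" for k
  proof (rule LIMSEQ_le[OF _ lim])
    show "(\<lambda>n. c n - exp (- \<delta> * real k) * d n) \<longlonglongrightarrow> C - exp (- \<delta> * real k) * D"
      by (intro tendsto_intros mom mom')
  qed (intro exI[of _ 0] allI impI lower)
  have upper': "integral\<^sup>L M (?g k) \<le> C" for k
    by (rule LIMSEQ_le[OF lim mom(2)]) (intro exI[of _ 0] allI impI upper)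
  have lim': "(\<lambda>k. integral\<^sup>L M (?g k)) \<longlonglongrightarrow> C"
  proof (rule tendsto_sandwich[OF _ _ _ tendsto_const])
    show "(\<lambda>k. C - exp (- \<delta> * real k) * D) \<longlonglongrightarrow> C"
      using \<open>\<delta> > 0\<close> by real_asymp
  qed (use lower' upper' in auto)
  have mono: "AE x in M. mono (\<lambda>k. ?g k x)"
    by (auto intro!: monoI min.mono)
  have "(\<lambda>k. ?g k x) \<longlonglongrightarrow> exp (- s * x)" for x
  proof (rule tendsto_eventually)
    show "\<forall>\<^sub>F k in sequentially. ?g k x = exp (- s * x)"
      using eventually_ge_at_top[of "nat \<lceil>- s * x\<rceil>"]
    proof eventually_elim
      case (elim k)
      then have "- s * x \<le> real k"
        by (simp only: nat_ceiling_le_eq)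
      then show ?case by (simp only: exp_le_cancel_iff min_absorb1)
    qed
  qed
  then have ptw: "AE x in M. (\<lambda>k. ?g k x) \<longlonglongrightarrow> exp (- s * x)"
    by simp
  show ?thesis
    unfolding has_bochner_integral_iff
    using integral_monotone_convergence_nonneg[OF g_int[OF rd(2)] mono _ ptw lim'] by auto
qed

text \<open>
  The continuity theorem for Laplace transforms. That the transforms exist on an interval
  around \<open>0\<close> gives tightness, through the moment at \<open>s = - 1 / 2\<close>; and as the interval is open, each of
  its points leaves room for the slightly larger exponent that controls the truncation.
\<close>

lemma exists_weak_limit_with_exp_moments:
  assumes rd: "\<And>n. real_distribution (P n)" and nonneg: "\<And>n. AE x in P n. x \<ge> 0"
    and mom: "\<And>n s. s > -1 \<Longrightarrow> has_bochner_integral (P n) (\<lambda>x. exp (- s * x)) (\<phi> n s)"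
    and lim: "\<And>s. s > -1 \<Longrightarrow> (\<lambda>n. \<phi> n s) \<longlonglongrightarrow> \<psi> s"
  shows "\<exists>M. real_distribution M \<and> (AE x in M. x \<ge> 0) \<and>
    (\<forall>s>-1. has_bochner_integral M (\<lambda>x. exp (- s * x)) (\<psi> s))"
proof -
  have "Bseq (\<lambda>n. \<phi> n (- 1 / 2))"
    by (rule convergent_imp_Bseq) (use lim[of "- 1 / 2"] in \<open>auto simp: convergent_def\<close>)
  then obtain C where C: "\<And>n. norm (\<phi> n (- 1 / 2)) \<le> C"
    unfolding Bseq_def by blast
  have "tight P"
  proof (rule tight_if_exp_moment_bounded[OF rd nonneg])
    show "(0::real) < 1 / 2" by simp
    show "has_bochner_integral (P n) (\<lambda>x. exp (1 / 2 * x)) (\<phi> n (- 1 / 2))" for n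
      using mom[of "- 1 / 2" n] by simp
    show "\<phi> n (- 1 / 2) \<le> C" for n
      using C[of n] by simp
  qed
  from tight_imp_convergent_subsubsequence[OF this strict_mono_id]
  obtain r M where r: "strict_mono (r :: nat \<Rightarrow> nat)" and M: "real_distribution M"
    and conv: "weak_conv_m (P \<circ> r) M"
    by (auto simp: o_def)
  have lim': "(\<lambda>n. \<phi> (r n) s) \<longlonglongrightarrow> \<psi> s" if "s > -1" for s
    using LIMSEQ_subseq_LIMSEQ[OF lim[OF that] r] by (simp add: o_def)
  have rd': "real_distribution ((P \<circ> r) n)" and nonneg': "AE x in (P \<circ> r) n. x \<ge> 0" for n
    using rd[of "r n"] nonneg[of "r n"] by (simp_all only: o_apply)
  show ?thesis
  proof (intro exI conjI allI impI)
    show "real_distribution M" by (rule M)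
    show "AE x in M. x \<ge> 0"
      by (rule weak_conv_AE_nonneg[OF rd' M conv nonneg'])
    fix s :: real assume s: "s > -1"
    \<comment> \<open>The choice \<open>\<delta> = (1 + s) / 2\<close> keeps the exponent \<open>(1 + \<delta>) s\<close> above \<open>-1\<close>.\<close>
    have s': "(1 + (1 + s) / 2) * s > -1"
    proof -
      have "(1 + (1 + s) / 2) * s + 1 = (s + 1) * (s / 2 + 1)"
        by (simp add: field_simps)
      also have "\<dots> > 0"
        using s by simp
      finally show ?thesis by simp
    qed
    show "has_bochner_integral M (\<lambda>x. exp (- s * x)) (\<psi> s)"
      by (rule weak_conv_exp_moment[OF rd' M conv, where \<delta> = "(1 + s) / 2"])
        (use s s' mom lim' in \<open>simp_all only: o_apply, auto\<close>)
  qed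
qed

lemma taylor_point_tendsto:
  assumes A: "cm_family A" and "t > 0"
  shows "(\<lambda>n. A 0 (real (Suc n) * (1 - exp (- t / real (Suc n))))) \<longlonglongrightarrow> A 0 t"
proof (rule isCont_tendsto_compose[OF DERIV_isCont[OF cm_family_DERIV[OF A \<open>t > 0\<close>]]])
  show "(\<lambda>n. real (Suc n) * (1 - exp (- t / real (Suc n)))) \<longlonglongrightarrow> t"
    using \<open>t > 0\<close> by real_asymp
qed

section \<open>Bernstein representation\<close>

text \<open>
  The limit law \<open>M\<close> of the approximating laws has the transform \<open>f (s + 1) / f 1\<close>; multiplying \<open>M\<close> by
  \<open>f 1 * exp x\<close> undoes the normalisation and the exponential factor. Positivity of \<open>f\<close> is
  used for the normalisation.
\<close>

theorem bernstein_representation: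
  assumes cm: "completely_monotone f" and pos: "\<And>x. x > 0 \<Longrightarrow> f x > 0"
  obtains \<mu> where "laplace_representative \<mu> f"
proof -
  define A where "A = signed_deriv f"
  have A: "cm_family A" and f: "A 0 = f"
    using cm_family_signed_deriv[OF cm] by (simp_all add: A_def fun_eq_iff signed_deriv_def)
  define \<phi> where "\<phi> n s = (let m = real (Suc n) in
      f (m * (1 - exp (- (s + 1) / m))) / f (m * (1 - exp (- 1 / m))))" for n s
  have "\<exists>P. real_distribution P \<and> (AE x in P. x \<ge> 0) \<and>
      (\<forall>s>-1. has_bochner_integral P (\<lambda>x. exp (- s * x)) (\<phi> n s))" for n
    by (rule tilted_taylor_law[OF A, of "real (Suc n)"]) (auto simp: f pos \<phi>_def Let_def)
  then obtain P where P: "\<And>n. real_distribution (P n)" "\<And>n. AE x in P n. x \<ge> 0"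
      "\<And>n s. s > -1 \<Longrightarrow> has_bochner_integral (P n) (\<lambda>x. exp (- s * x)) (\<phi> n s)"
    by metis
  have lim: "(\<lambda>n. \<phi> n s) \<longlonglongrightarrow> f (s + 1) / f 1" if "s > -1" for s
    unfolding \<phi>_def Let_def using that pos[of 1]
      taylor_point_tendsto[OF A, of "s + 1"] taylor_point_tendsto[OF A, of 1]
    by (auto intro!: tendsto_divide simp: f)
  obtain M where M: "real_distribution M" "AE x in M. x \<ge> 0"
    and mom: "\<And>s. s > -1 \<Longrightarrow> has_bochner_integral M (\<lambda>x. exp (- s * x)) (f (s + 1) / f 1)"
    using exists_weak_limit_with_exp_moments[of P \<phi> "\<lambda>s. f (s + 1) / f 1", OF P lim] by auto
  interpret M: real_distribution M by (rule M)
  define \<mu> where "\<mu> = density (restrict_space M {0..}) (\<lambda>x. ennreal (f 1 * exp x))"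
  have int: "has_bochner_integral \<mu> (\<lambda>x. exp (- t * x)) (f t)" if "t > 0" for t
    unfolding \<mu>_def
  proof (rule has_bochner_integral_density)
    have "has_bochner_integral M (\<lambda>x. f 1 * exp (- (t - 1) * x)) (f 1 * (f (t - 1 + 1) / f 1))"
      using that by (intro has_bochner_integral_mult_right mom) auto
    then have "has_bochner_integral M (\<lambda>x. f 1 * exp (- (t - 1) * x)) (f t)"
      using pos[of 1] by simp
    moreover have "AE x in M. f 1 * exp (- (t - 1) * x)
        = indicator {0..} x *\<^sub>R ((f 1 * exp x) *\<^sub>R exp (- t * x))"
      using M(2) by eventually_elim (simp add: algebra_simps flip: exp_add)
    ultimately have "has_bochner_integral M
        (\<lambda>x. indicator {0..} x *\<^sub>R ((f 1 * exp x) *\<^sub>R exp (- t * x))) (f t)"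
      by (subst (asm) has_bochner_integral_cong_AE) auto
    then show "has_bochner_integral (restrict_space M {0..})
        (\<lambda>x. (f 1 * exp x) *\<^sub>R exp (- t * x)) (f t)"
      by (subst has_bochner_integral_restrict_space) auto
  qed (use pos[of 1] in \<open>auto intro!: measurable_restrict_space1\<close>)
  have fin: "emeasure \<mu> K < \<infinity>" if K: "compact K \<and> K \<subseteq> {0..}" for K
  proof -
    obtain r where r: "\<And>x. x \<in> K \<Longrightarrow> x \<le> r"
      using K compact_imp_bounded bounded_imp_bdd_above bdd_above_def by metis
    have K': "K \<in> sets \<mu>"
      using K by (auto simp: \<mu>_def sets_restrict_space borel_compact intro!: image_eqI[of _ _ K])
    \<comment> \<open>On \<open>K\<close> the integrable function \<open>exp (- x)\<close> is at least \<open>exp (- r)\<close>.\<close>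
    have "emeasure \<mu> K = (\<integral>\<^sup>+x. indicator K x \<partial>\<mu>)"
      using K' by simp
    also have "\<dots> \<le> (\<integral>\<^sup>+x. ennreal (exp r * exp (- 1 * x)) \<partial>\<mu>)"
      using r by (intro nn_integral_mono) (auto simp: indicator_def simp flip: exp_add)
    also have "\<dots> < \<infinity>"
      using int[of 1] by (subst nn_integral_eq_integral) (auto simp: has_bochner_integral_iff)
    finally show ?thesis .
  qed
  have "sets \<mu> = sets (restrict_space borel {0..})"
    by (simp add: \<mu>_def sets_restrict_space)
  with int fin have "laplace_representative \<mu> f"
    by (simp add: laplace_representative_def)
  then show thesis by (rule that)
qed

section \<open>Complete monotonicity in terms of differences\<close>

text \<open>
  The representation is applied to \<open>\<Psi> + 1\<close>, which is positive and has the same differences as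
  \<open>\<Psi>\<close>. The added constant puts mass at \<open>0\<close>, but there the density \<open>1 - exp (- c x)\<close>
  of the representative measure of the difference vanishes.
\<close>

lemma cm_diff_if_completely_monotone:
  assumes cm: "completely_monotone \<Psi>" and "c > 0"
  shows "cm_diff_without_mass_at_zero c \<Psi>"
proof -
  define f where "f x = \<Psi> x + 1" for x
  note A = cm_family_signed_deriv[OF cm]
  have "cm_family (\<lambda>n x. signed_deriv \<Psi> n x + (if n = 0 then 1 else 0))"
    by (intro cm_family_add_const[OF A] add_nonneg_nonneg cm_family_nonneg[OF A]) simp_all
  then have f: "completely_monotone f"
    by (rule completely_monotone_if_cm_family) (simp add: f_def signed_deriv_def)
  have "f x > 0" if "x > 0" for x
    using cm_family_nonneg[OF A that, of 0] by (simp add: f_def signed_deriv_def)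
  with f obtain \<mu> where \<mu>: "laplace_representative \<mu> f"
    by (rule bernstein_representation)
  have sets: "sets \<mu> = sets (restrict_space borel {0..})"
    and fin: "\<And>K. compact K \<and> K \<subseteq> {0..} \<Longrightarrow> emeasure \<mu> K < \<infinity>"
    and int: "\<And>t. t > 0 \<Longrightarrow> has_bochner_integral \<mu> (\<lambda>x. exp (- t * x)) (f t)"
    using \<mu> by (auto simp: laplace_representative_def)
  have meas: "g \<in> borel_measurable \<mu>" if "g \<in> borel_measurable borel" for g :: "real \<Rightarrow> real"
    unfolding measurable_cong_sets[OF sets refl] using that by (rule measurable_restrict_space1)
  have space: "space \<mu> = {0..}"
    using sets_eq_imp_space_eq[OF sets] by (simp add: space_restrict_space)
  define \<nu> where "\<nu> = density \<mu> (\<lambda>x. ennreal (1 - exp (- c * x)))"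
  have "has_bochner_integral \<nu> (\<lambda>x. exp (- t * x)) (neg_forward_diff c \<Psi> t)" if "t > 0" for t
    unfolding \<nu>_def
  proof (rule has_bochner_integral_density)
    have "has_bochner_integral \<mu> (\<lambda>x. exp (- t * x) - exp (- (t + c) * x)) (f t - f (t + c))"
      using that \<open>c > 0\<close> by (intro has_bochner_integral_diff int) auto
    then show "has_bochner_integral \<mu> (\<lambda>x. (1 - exp (- c * x)) *\<^sub>R exp (- t * x))
        (neg_forward_diff c \<Psi> t)"
      by (simp add: f_def neg_forward_diff_def forward_diff_def algebra_simps flip: exp_add)
    show "AE x in \<mu>. 0 \<le> 1 - exp (- c * x)"
      using \<open>c > 0\<close> by (intro AE_I2) (auto simp: space)
  qed (auto intro: meas)
  moreover have "emeasure \<nu> K < \<infinity>" if K: "compact K \<and> K \<subseteq> {0..}" for K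
  proof -
    have K': "K \<in> sets \<mu>"
      using K by (auto simp: sets sets_restrict_space borel_compact intro!: image_eqI[of _ _ K])
    then have "emeasure \<nu> K = (\<integral>\<^sup>+x. ennreal (1 - exp (- c * x)) * indicator K x \<partial>\<mu>)"
      unfolding \<nu>_def by (intro emeasure_density measurable_compose[OF meas measurable_ennreal]) auto
    also have "\<dots> \<le> (\<integral>\<^sup>+x. indicator K x \<partial>\<mu>)"
      by (intro nn_integral_mono) (auto simp: indicator_def)
    also have "\<dots> < \<infinity>"
      using fin[OF K] K' by simp
    finally show ?thesis .
  qed
  moreover have "sets \<nu> = sets (restrict_space borel {0..})"
    by (simp add: \<nu>_def sets)
  ultimately have \<nu>: "laplace_representative \<nu> (neg_forward_diff c \<Psi>)"
    by (simp add: laplace_representative_def)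
  have "{0} \<in> sets \<mu>"
    by (auto simp: sets sets_restrict_space intro!: image_eqI[of _ _ "{0}"])
  then have "emeasure \<nu> {0} = (\<integral>\<^sup>+x. ennreal (1 - exp (- c * x)) * indicator {0} x \<partial>\<mu>)"
    unfolding \<nu>_def by (intro emeasure_density measurable_compose[OF meas measurable_ennreal]) auto
  also have "\<dots> = (\<integral>\<^sup>+x. 0 \<partial>\<mu>)"
    by (intro nn_integral_cong) (auto simp: indicator_def)
  finally have "emeasure \<nu> {0} = 0"
    by simp
  with \<nu> show ?thesis
    unfolding cm_diff_without_mass_at_zero_def
    using completely_monotone_neg_forward_diff[OF cm] \<open>c > 0\<close> by auto
qed

lemma tendsto_if_neg_forward_diff_nonneg:
  assumes nonneg: "\<And>x. x > 0 \<Longrightarrow> \<Psi> x \<ge> 0"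
    and diff: "\<And>c x. c > 0 \<Longrightarrow> x > 0 \<Longrightarrow> neg_forward_diff c \<Psi> x \<ge> 0"
  obtains L where "(\<Psi> \<longlongrightarrow> L) at_top"
proof (rule antimono_nonneg_tendsto[OF nonneg])
  show "\<Psi> y \<le> \<Psi> x" if "0 < x" "x \<le> y" for x y
    using diff[of "y - x" x] that
    by (cases "x = y") (auto simp: neg_forward_diff_def forward_diff_def)
qed auto

theorem proposition1:
  fixes \<Psi> :: "real \<Rightarrow> real"
  assumes nonneg: "\<And>x. x > 0 \<Longrightarrow> \<Psi> x \<ge> 0"
    and meas: "\<Psi> \<in> borel_measurable (restrict_space borel {0<..})"
  shows
    "(completely_monotone \<Psi> \<longleftrightarrow> (\<forall>c>0. cm_diff_without_mass_at_zero c \<Psi>)) \<and>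
     (completely_monotone \<Psi> \<longleftrightarrow>
        (\<exists>c>0. cm_diff_without_mass_at_zero c \<Psi>) \<and> (\<exists>L. (\<Psi> \<longlongrightarrow> L) at_top)) \<and>
     (completely_monotone \<Psi> \<longrightarrow>
        (\<exists>L G. (\<Psi> \<longlongrightarrow> L) at_top \<and>
           completely_monotone G \<and>
           (\<forall>t>0. \<Psi> t = L + G t) \<and>
           (\<forall>c>0. \<forall>k.
              (\<forall>t>0. (\<lambda>n. (deriv ^^ k) (neg_forward_diff (real n * c) \<Psi>) t)
                        \<longlonglongrightarrow> (deriv ^^ k) G t) \<and>
              locally_uniform_limit_pos
                (\<lambda>n. (deriv ^^ k) (neg_forward_diff (real n * c) \<Psi>)) ((deriv ^^ k) G))))"
proof -
  have diff_nonneg: "neg_forward_diff c \<Psi> x \<ge> 0"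
    if "cm_diff_without_mass_at_zero c \<Psi>" "x > 0" for c x
    using that cm_family_nonneg[OF cm_family_signed_deriv, of "neg_forward_diff c \<Psi>" x 0]
    by (simp add: cm_diff_without_mass_at_zero_def signed_deriv_def)
  have limit: "\<exists>L. (\<Psi> \<longlongrightarrow> L) at_top" if all: "\<forall>c>0. cm_diff_without_mass_at_zero c \<Psi>"
  proof -
    obtain L where "(\<Psi> \<longlongrightarrow> L) at_top"
      by (rule tendsto_if_neg_forward_diff_nonneg[OF nonneg diff_nonneg]) (use all in auto)
    then show ?thesis by blast
  qed
  have cm: "completely_monotone \<Psi>"
    if "cm_diff_without_mass_at_zero c \<Psi>" "c > 0" "(\<Psi> \<longlongrightarrow> L) at_top" for c L
    using completely_monotone_if_diff[OF nonneg that(3) _ that(2)] that(1)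
    by (simp add: cm_diff_without_mass_at_zero_def)
  have all_iff: "completely_monotone \<Psi> \<longleftrightarrow> (\<forall>c>0. cm_diff_without_mass_at_zero c \<Psi>)"
  proof
    assume *: "\<forall>c>0. cm_diff_without_mass_at_zero c \<Psi>"
    with limit obtain L where "(\<Psi> \<longlongrightarrow> L) at_top" by blast
    with * show "completely_monotone \<Psi>"
      using cm[of 1 L] by simp
  qed (use cm_diff_if_completely_monotone in blast)
  have "completely_monotone \<Psi> \<longleftrightarrow>
      (\<exists>c>0. cm_diff_without_mass_at_zero c \<Psi>) \<and> (\<exists>L. (\<Psi> \<longlongrightarrow> L) at_top)"
  proof
    assume "completely_monotone \<Psi>"
    then have "\<forall>c>0. cm_diff_without_mass_at_zero c \<Psi>"
      using all_iff by simp
    then show "(\<exists>c>0. cm_diff_without_mass_at_zero c \<Psi>) \<and> (\<exists>L. (\<Psi> \<longlongrightarrow> L) at_top)"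
      using limit zero_less_one by (intro conjI) (rule exI[of _ 1], simp_all)
  qed (use cm in \<open>elim conjE exE, simp\<close>)
  moreover have "\<exists>L G. (\<Psi> \<longlongrightarrow> L) at_top \<and> completely_monotone G \<and>
      (\<forall>t>0. \<Psi> t = L + G t) \<and>
      (\<forall>c>0. \<forall>k.
         (\<forall>t>0. (\<lambda>n. (deriv ^^ k) (neg_forward_diff (real n * c) \<Psi>) t)
                   \<longlonglongrightarrow> (deriv ^^ k) G t) \<and>
         locally_uniform_limit_pos
           (\<lambda>n. (deriv ^^ k) (neg_forward_diff (real n * c) \<Psi>)) ((deriv ^^ k) G))"
    if \<Psi>: "completely_monotone \<Psi>"
  proof -
    obtain L where L: "(\<Psi> \<longlongrightarrow> L) at_top"
      using limit all_iff \<Psi> by blast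
    show ?thesis
      by (intro exI[of _ L] exI[of _ "\<lambda>t. \<Psi> t - L"])
        (auto simp: L completely_monotone_limit_diffs[OF \<Psi> L])
  qed
  ultimately show ?thesis
    using all_iff by blast
qed

end
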